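(* Fix an integer $n>0$ and let $R(t)$ be a rational function over $\mathbb{C}$ of the form $$R(t) = \sum_{k=0}^n\biggl(\frac{B_{k2}}{(t+k)^2}+\frac{B_{k1}}{t+k}\biggr),$$ with $B_{k1},B_{k2}\in\mathbb{C}$ for $0\le k\le n$. If $R(t)=O(t^{-3})$ as $t\to\infty$, then $$\sum_{\nu=n+1}^\infty \int_\nu^\infty R(t)\,dt = B\gamma + L - A,$$ where $$B := \sum_{k=0}^n B_{k2},\qquad L := \sum_{m=1}^n\sum_{k=m}^n B_{k1}\log(n+m),\qquad A := \sum_{k=0}^n B_{k2}H_{n+k}.$$
   Context: $H_N := \sum_{k=1}^N \frac1k$ is the $N$th harmonic number, and Euler's constant is $\gamma := \lim_{N\to\infty}(H_N-\log N)$. *)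

theory Defs
  imports "HOL-Analysis.Analysis" "HOL-Library.Landau_Symbols"
begin

end

theory Submission
  imports Defs "HOL-Real_Asymp.Real_Asymp"
begin

text \<open>
  Comparing the expansion of \<open>R\<close> at infinity with the decay condition gives
  \<open>\<Sum>k B k 1 = 0\<close> and \<open>\<Sum>k B k 2 = \<Sum>k k * B k 1\<close>. By the first relation, each
  \<open>1 / (t + k)\<close> may be replaced by \<open>1 / (t + k) - 1 / t\<close>, so that \<open>R\<close> becomes a combination of
  integrable functions of constant sign and the integrals over \<open>{\<nu>..}\<close> are
  \<open>\<Sum>k B k 2 / (\<nu> + k) - B k 1 * (ln (\<nu> + k) - ln \<nu>)\<close>. The partial sums over \<open>\<nu>\<close> telescope to
  harmonic numbers and logarithms; by the second relation the \<open>ln N\<close> terms cancel, leaving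
  \<open>harm (N + k) - ln N\<close>, which tends to Euler's constant, and \<open>ln (N + m) - ln N\<close>, which
  tends to \<open>0\<close>.
\<close>

text \<open>For nonnegative \<open>f\<close> the fundamental theorem on a half-line is available for
  \<open>nn_integral\<close>. Since \<open>F\<close> is nondecreasing, \<open>F a \<le> T\<close>,
  so the value carries over from \<open>ennreal\<close> to a Bochner integral, which yields
  integrability and value together.\<close>

lemma has_bochner_integral_FTC_atLeast:
  fixes f F :: "real \<Rightarrow> real"
  assumes [measurable]: "f \<in> borel_measurable borel"
    and deriv: "\<And>x. a \<le> x \<Longrightarrow> DERIV F x :> f x"
    and nonneg: "\<And>x. a \<le> x \<Longrightarrow> 0 \<le> f x"
    and lim: "(F \<longlongrightarrow> T) at_top"
  shows "has_bochner_integral lborel (\<lambda>x. indicator {a..} x *\<^sub>R f x) (T - F a)"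
proof (rule has_bochner_integral_nn_integral)
  have "F a \<le> F x" if "a \<le> x" for x
    using that deriv nonneg
    by (intro DERIV_nonneg_imp_nondecreasing[of a x F]) (auto intro: order_trans)
  then have "F a \<le> T"
    by (intro tendsto_lowerbound[OF lim] eventually_at_top_linorderI[of a]) auto
  then show "0 \<le> T - F a" by simp
  have "(\<integral>\<^sup>+x. ennreal (indicator {a..} x *\<^sub>R f x) \<partial>lborel)
      = (\<integral>\<^sup>+x. ennreal (f x) * indicator {a..} x \<partial>lborel)"
    by (intro nn_integral_cong) (auto split: split_indicator)
  also have "\<dots> = ennreal (T - F a)"
    using nn_integral_FTC_atLeast[OF assms] by simp
  finally show "(\<integral>\<^sup>+x. ennreal (indicator {a..} x *\<^sub>R f x) \<partial>lborel) = ennreal (T - F a)" .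
qed (auto split: split_indicator intro!: AE_I2 nonneg)

lemma has_bochner_integral_inverse_square_atLeast:
  fixes a c :: real
  assumes "a + c > 0"
  shows "has_bochner_integral lborel (\<lambda>t. indicator {a..} t *\<^sub>R (1 / (t + c)\<^sup>2)) (1 / (a + c))"
proof -
  have "has_bochner_integral lborel (\<lambda>t. indicator {a..} t *\<^sub>R (1 / (t + c)\<^sup>2))
      (0 - (- 1 / (a + c)))"
  proof (rule has_bochner_integral_FTC_atLeast[where F = "\<lambda>t. - 1 / (t + c)"])
    show "((\<lambda>t. - 1 / (t + c)) \<longlongrightarrow> 0) at_top"
      by real_asymp
    show "((\<lambda>t. - 1 / (t + c)) has_real_derivative 1 / (x + c)\<^sup>2) (at x)" if "a \<le> x" for x
      using assms that by (auto intro!: derivative_eq_intros simp: power2_eq_square)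
  qed auto
  then show ?thesis by simp
qed

text \<open>Neither fraction is integrable alone when \<open>c > 0\<close>, but the difference is
  nonnegative and its antiderivative \<open>ln t - ln (t + c)\<close> vanishes at infinity.\<close>

lemma has_bochner_integral_inverse_diff_atLeast:
  fixes a c :: real
  assumes "a > 0" "c \<ge> 0"
  shows "has_bochner_integral lborel (\<lambda>t. indicator {a..} t *\<^sub>R (1 / t - 1 / (t + c)))
           (ln (a + c) - ln a)"
proof -
  have "has_bochner_integral lborel (\<lambda>t. indicator {a..} t *\<^sub>R (1 / t - 1 / (t + c)))
      (0 - (ln a - ln (a + c)))"
  proof (rule has_bochner_integral_FTC_atLeast)
    show "((\<lambda>t. ln t - ln (t + c)) \<longlongrightarrow> 0) at_top"
      by real_asymp
    show "((\<lambda>t. ln t - ln (t + c)) has_real_derivative 1 / x - 1 / (x + c)) (at x)"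
      if "a \<le> x" for x
      using assms that by (auto intro!: derivative_eq_intros)
    show "0 \<le> 1 / x - 1 / (x + c)" if "a \<le> x" for x
      using assms that by (auto simp: field_simps)
  qed auto
  then show ?thesis by simp
qed

text \<open>As an introduction rule this turns limits of complex summands into limits of real
  functions, which \<open>real_asymp\<close> can settle.\<close>

lemma tendsto_cmult_of_real:
  "(f \<longlongrightarrow> l) F \<Longrightarrow> ((\<lambda>x. c * complex_of_real (f x)) \<longlongrightarrow> c * complex_of_real l) F"
  by (intro tendsto_intros)

text \<open>The two relations say that the coefficients of \<open>1 / t\<close> and
  \<open>1 / t\<^sup>2\<close> in the expansion at infinity vanish. They are read off from the
  limits of \<open>t * R t\<close> and \<open>t\<^sup>2 * R t\<close>, which the decay forces to be
  \<open>0\<close>.\<close>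

lemma partial_fraction_coeff_relations:
  fixes n :: nat and b c :: "nat \<Rightarrow> complex"
  assumes decay: "(\<lambda>t::real. \<Sum>k=0..n. b k / (of_real t + of_nat k)\<^sup>2 + c k / (of_real t + of_nat k))
      \<in> O[at_top](\<lambda>t. 1 / complex_of_real t ^ 3)"
  shows "(\<Sum>k=0..n. c k) = 0" "(\<Sum>k=0..n. b k) = (\<Sum>k=0..n. of_nat k * c k)"
proof -
  define R where "R = (\<lambda>t::real. \<Sum>k=0..n. b k / (of_real t + of_nat k)\<^sup>2 + c k / (of_real t + of_nat k))"
  have lim0: "((\<lambda>t. complex_of_real t ^ i * R t) \<longlongrightarrow> 0) at_top" if less: "i < 3" for i
  proof -
    have "(\<lambda>t. complex_of_real t ^ i * R t)
        \<in> O[at_top](\<lambda>t. complex_of_real t ^ i * (1 / complex_of_real t ^ 3))"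
      using decay unfolding R_def by (intro landau_o.big.mult landau_o.big_refl)
    also have "(\<lambda>t. complex_of_real t ^ i * (1 / complex_of_real t ^ 3))
        = (\<lambda>t. complex_of_real (t ^ i / t ^ 3))"
      by simp
    also have "\<dots> \<in> o[at_top](\<lambda>_. 1)"
    proof -
      have "((\<lambda>t::real. t ^ i / t ^ 3) \<longlongrightarrow> 0) at_top"
      proof -
        consider "i = 0" | "i = 1" | "i = 2" using less by linarith
        then show ?thesis by cases (simp; real_asymp)+
      qed
      then have "((\<lambda>t::real. complex_of_real (t ^ i / t ^ 3)) \<longlongrightarrow> 0) at_top"
        by (metis tendsto_of_real of_real_0)
      then show ?thesis by (intro smalloI_tendsto) auto
    qed
    finally show ?thesis by (auto dest: smalloD_tendsto)
  qed
  have "((\<lambda>t. \<Sum>k=0..n. b k * of_real (t / (t + real k)\<^sup>2) + c k * of_real (t / (t + real k)))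
      \<longlongrightarrow> (\<Sum>k=0..n. b k * of_real 0 + c k * of_real 1)) at_top"
    by (intro tendsto_sum tendsto_add tendsto_cmult_of_real; real_asymp)
  moreover have "(\<lambda>t. \<Sum>k=0..n. b k * of_real (t / (t + real k)\<^sup>2) + c k * of_real (t / (t + real k)))
      = (\<lambda>t. complex_of_real t ^ 1 * R t)"
    by (auto simp: R_def sum_distrib_left algebra_simps)
  ultimately have "((\<lambda>t. complex_of_real t ^ 1 * R t) \<longlongrightarrow> (\<Sum>k=0..n. c k)) at_top"
    by simp
  then show c0: "(\<Sum>k=0..n. c k) = 0"
    using lim0[of 1] by (intro tendsto_unique[of at_top]) auto
  \<comment> \<open>Each \<open>t\<^sup>2 / (t + k)\<close> grows like \<open>t\<close>. Subtracting
    \<open>t\<close> makes it converge to \<open>- k\<close>, and the subtracted terms add up to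
    \<open>0\<close> by the first relation.\<close>
  have "((\<lambda>t. \<Sum>k=0..n. b k * of_real (t\<^sup>2 / (t + real k)\<^sup>2) + c k * of_real (t\<^sup>2 / (t + real k) - t))
      \<longlongrightarrow> (\<Sum>k=0..n. b k * of_real 1 + c k * of_real (- real k))) at_top"
    by (intro tendsto_sum tendsto_add tendsto_cmult_of_real; real_asymp)
  moreover have "(\<lambda>t. \<Sum>k=0..n. b k * of_real (t\<^sup>2 / (t + real k)\<^sup>2) + c k * of_real (t\<^sup>2 / (t + real k) - t))
      = (\<lambda>t. complex_of_real t ^ 2 * R t)"
  proof
    fix t :: real
    have "(\<Sum>k=0..n. b k * of_real (t\<^sup>2 / (t + real k)\<^sup>2) + c k * of_real (t\<^sup>2 / (t + real k) - t))
        = complex_of_real t ^ 2 * R t - (\<Sum>k=0..n. c k) * of_real t"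
      by (simp add: R_def sum_distrib_left sum_distrib_right sum.distrib sum_subtractf algebra_simps)
    then show "(\<Sum>k=0..n. b k * of_real (t\<^sup>2 / (t + real k)\<^sup>2) + c k * of_real (t\<^sup>2 / (t + real k) - t))
        = complex_of_real t ^ 2 * R t"
      using c0 by simp
  qed
  ultimately have "((\<lambda>t. complex_of_real t ^ 2 * R t)
      \<longlongrightarrow> (\<Sum>k=0..n. b k) - (\<Sum>k=0..n. of_nat k * c k)) at_top"
    by (simp add: sum_subtractf mult.commute)
  then have "(\<Sum>k=0..n. b k) - (\<Sum>k=0..n. of_nat k * c k) = 0"
    using lim0[of 2] by (intro tendsto_unique[of at_top]) auto
  then show "(\<Sum>k=0..n. b k) = (\<Sum>k=0..n. of_nat k * c k)"
    by simp
qed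

lemma has_bochner_integral_partial_fraction_atLeast:
  fixes n :: nat and b c :: "nat \<Rightarrow> complex" and a :: real
  assumes "a > 0" and c0: "(\<Sum>k=0..n. c k) = 0"
  shows "has_bochner_integral lborel
      (\<lambda>t. indicator {a..} t *\<^sub>R
        (\<Sum>k=0..n. b k / (complex_of_real t + of_nat k)\<^sup>2 + c k / (complex_of_real t + of_nat k)))
      (\<Sum>k=0..n. b k * of_real (1 / (a + real k)) - c k * of_real (ln (a + real k) - ln a))"
proof -
  have "has_bochner_integral lborel
      (\<lambda>t. \<Sum>k=0..n. b k * complex_of_real (indicator {a..} t *\<^sub>R (1 / (t + real k)\<^sup>2))
          - c k * complex_of_real (indicator {a..} t *\<^sub>R (1 / t - 1 / (t + real k))))
      (\<Sum>k=0..n. b k * of_real (1 / (a + real k)) - c k * of_real (ln (a + real k) - ln a))"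
    using assms
    by (intro has_bochner_integral_sum has_bochner_integral_diff has_bochner_integral_mult_right
        has_bochner_integral_of_real has_bochner_integral_inverse_square_atLeast
        has_bochner_integral_inverse_diff_atLeast) auto
  also have "(\<lambda>t. \<Sum>k=0..n. b k * complex_of_real (indicator {a..} t *\<^sub>R (1 / (t + real k)\<^sup>2))
          - c k * complex_of_real (indicator {a..} t *\<^sub>R (1 / t - 1 / (t + real k))))
      = (\<lambda>t. indicator {a..} t *\<^sub>R
        (\<Sum>k=0..n. b k / (complex_of_real t + of_nat k)\<^sup>2 + c k / (complex_of_real t + of_nat k)))"
  proof
    fix t :: real
    \<comment> \<open>The inserted terms \<open>c k / t\<close> add up to \<open>0\<close> by
      \<open>c0\<close>.\<close>
    have "(\<Sum>k=0..n. b k * complex_of_real (1 / (t + real k)\<^sup>2)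
            - c k * complex_of_real (1 / t - 1 / (t + real k)))
        = (\<Sum>k=0..n. b k / (complex_of_real t + of_nat k)\<^sup>2 + c k / (complex_of_real t + of_nat k))
          - (\<Sum>k=0..n. c k) / of_real t"
      by (simp add: sum.distrib sum_subtractf sum_divide_distrib algebra_simps)
    then show "(\<Sum>k=0..n. b k * complex_of_real (indicator {a..} t *\<^sub>R (1 / (t + real k)\<^sup>2))
          - c k * complex_of_real (indicator {a..} t *\<^sub>R (1 / t - 1 / (t + real k))))
      = indicator {a..} t *\<^sub>R
        (\<Sum>k=0..n. b k / (complex_of_real t + of_nat k)\<^sup>2 + c k / (complex_of_real t + of_nat k))"
      using c0 by (simp split: split_indicator)
  qed
  finally show ?thesis .
qed

text \<open>Raising \<open>k\<close> by one adds a sum over \<open>j\<close> that telescopes. The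
  result has \<open>k\<close> terms, a number independent of \<open>J\<close>, so the limit in
  \<open>J\<close> can be taken term by term.\<close>

lemma sum_ln_shift_diff:
  "(\<Sum>j<J. ln (real (n + 1 + j) + real k) - ln (real (n + 1 + j)))
    = (\<Sum>m=1..k. ln (real (n + J + m)) - ln (real (n + m)))"
proof (induction k)
  case (Suc k)
  have "(\<Sum>j<J. ln (real (n + 1 + j) + real (Suc k)) - ln (real (n + 1 + j) + real k))
      = ln (real (n + J + Suc k)) - ln (real (n + Suc k))"
    by (induction J) (simp_all add: algebra_simps)
  moreover have "(\<Sum>j<J. ln (real (n + 1 + j) + real (Suc k)) - ln (real (n + 1 + j)))
      = (\<Sum>j<J. ln (real (n + 1 + j) + real (Suc k)) - ln (real (n + 1 + j) + real k))
        + (\<Sum>j<J. ln (real (n + 1 + j) + real k) - ln (real (n + 1 + j)))"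
    by (simp add: sum.distrib[symmetric])
  ultimately show ?case
    using Suc.IH by (simp add: add_ac)
qed simp

lemma sum_inverse_shift_eq_harm_diff:
  "(\<Sum>j<J. 1 / (real (n + 1 + j) + real k)) = harm (n + J + k) - harm (n + k)"
  by (induction J) (simp_all add: harm_Suc inverse_eq_divide add_ac)

text \<open>Shifting the index in the limit of \<open>harm N - ln N\<close> gives the logarithm of
  \<open>n + J + k\<close>; replacing it by that of \<open>n + J\<close> costs a null
  sequence.\<close>

lemma harm_shift_minus_ln_LIMSEQ:
  "(\<lambda>J. harm (n + J + k) - ln (real (n + J))) \<longlonglongrightarrow> (euler_mascheroni :: real)"
proof -
  have "(\<lambda>J. harm (J + (n + k)) - ln (real (J + (n + k)))) \<longlonglongrightarrow> (euler_mascheroni :: real)"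
    using euler_mascheroni_LIMSEQ by (rule LIMSEQ_ignore_initial_segment)
  moreover have "(\<lambda>J. ln (real J + real n + real k) - ln (real J + real n)) \<longlonglongrightarrow> 0"
    by real_asymp
  ultimately have "(\<lambda>J. (harm (J + (n + k)) - ln (real (J + (n + k))))
      + (ln (real J + real n + real k) - ln (real J + real n))) \<longlonglongrightarrow> (euler_mascheroni :: real) + 0"
    by (rule tendsto_add)
  then show ?thesis
    by (simp add: algebra_simps)
qed

text \<open>Both sides run over the triangle \<open>1 \<le> m \<le> k \<le> n\<close>; the inner sum
  for \<open>k = 0\<close> is empty.\<close>

lemma sum_triangle_swap:
  fixes g :: "nat \<Rightarrow> nat \<Rightarrow> 'a::comm_monoid_add"
  shows "(\<Sum>k=0..n. \<Sum>m=1..k. g k m) = (\<Sum>m=1..n. \<Sum>k=m..n. g k m)"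
  unfolding sum.Sigma[OF finite_atLeastAtMost ballI[OF finite_atLeastAtMost]]
  by (rule sum.reindex_bij_witness[of _ "\<lambda>(m, k). (k, m)" "\<lambda>(k, m). (m, k)"]) auto

lemma partial_fraction_integrals_sums:
  fixes n :: nat and b c :: "nat \<Rightarrow> complex"
  assumes rel: "(\<Sum>k=0..n. b k) = (\<Sum>k=0..n. of_nat k * c k)"
  shows "(\<lambda>j. \<Sum>k=0..n. b k * of_real (1 / (real (n + 1 + j) + real k))
            - c k * of_real (ln (real (n + 1 + j) + real k) - ln (real (n + 1 + j))))
        sums ((\<Sum>k=0..n. b k) * euler_mascheroni
         + (\<Sum>m=1..n. \<Sum>k=m..n. c k * complex_of_real (ln (real (n + m))))
         - (\<Sum>k=0..n. b k * harm (n + k)))" (is "?f sums ?S")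
proof -
  define L where "L = (\<Sum>k=0..n. \<Sum>m=1..k. c k * complex_of_real (ln (real (n + m))))"
  define A where "A = (\<Sum>k=0..n. b k * harm (n + k))"
  \<comment> \<open>\<open>g J\<close> is the partial sum rearranged so that every summand
    converges: \<open>ln (n + J)\<close> is subtracted next to each growing term, while
    \<open>L - A\<close> collects what does not depend on \<open>J\<close>. The total correction is
    a multiple of \<open>ln (n + J)\<close> whose factor is \<open>0\<close> by
    \<open>rel\<close>.\<close>
  define g where "g J = (\<Sum>k=0..n. b k * of_real (harm (n + J + k) - ln (real (n + J)))
      - c k * of_real (\<Sum>m=1..k. ln (real (n + J + m)) - ln (real (n + J)))) + (L - A)" for J
  have "sum ?f {..<J} = g J" for J
  proof -
    have "sum ?f {..<J} = (\<Sum>k=0..n. b k * of_real (\<Sum>j<J. 1 / (real (n + 1 + j) + real k))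
        - c k * of_real (\<Sum>j<J. ln (real (n + 1 + j) + real k) - ln (real (n + 1 + j))))"
      by (subst sum.swap) (simp only: of_real_sum of_real_diff right_diff_distrib sum_distrib_left sum_subtractf)
    also have "\<dots> = (\<Sum>k=0..n. b k * of_real (harm (n + J + k) - harm (n + k))
        - c k * of_real (\<Sum>m=1..k. ln (real (n + J + m)) - ln (real (n + m))))"
      by (simp only: sum_ln_shift_diff sum_inverse_shift_eq_harm_diff)
    also have "\<dots> = g J + ((\<Sum>k=0..n. b k) - (\<Sum>k=0..n. of_nat k * c k)) * of_real (ln (real (n + J)))"
      unfolding g_def L_def A_def
      by (simp add: sum.distrib sum_subtractf sum_distrib_left sum_distrib_right of_real_harm
          algebra_simps)
    finally show ?thesis
      using rel by simp
  qed
  \<comment> \<open>The zero sum is left unevaluated so that the limit has the shape which the limit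
    rules produce.\<close>
  moreover have "g \<longlonglongrightarrow> (\<Sum>k=0..n. b k * of_real euler_mascheroni
      - c k * of_real (\<Sum>m=1..k. 0)) + (L - A)"
  proof -
    have "(\<lambda>J. ln (real (n + J + m)) - ln (real (n + J))) \<longlonglongrightarrow> 0" for m
      unfolding of_nat_add by real_asymp
    then show ?thesis
      unfolding g_def
      by (intro tendsto_add tendsto_const tendsto_sum tendsto_diff tendsto_cmult_of_real
          harm_shift_minus_ln_LIMSEQ)
  qed
  moreover have "(\<Sum>k=0..n. b k * of_real euler_mascheroni
      - c k * of_real (\<Sum>m=1..k. 0)) + (L - A) = ?S"
    unfolding L_def A_def sum_triangle_swap by (simp add: sum_distrib_right)
  ultimately show ?thesis
    unfolding sums_def by simp
qed

theorem proposition1: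
  fixes n :: nat and B :: "nat \<Rightarrow> nat \<Rightarrow> complex" and R :: "complex \<Rightarrow> complex"
  assumes n_pos: "n > 0"
    and R_eq: "\<And>t. R t = (\<Sum>k=0..n. B k 2 / (t + of_nat k)\<^sup>2 + B k 1 / (t + of_nat k))"
    and decay: "(\<lambda>t::real. R (complex_of_real t)) \<in> O[at_top](\<lambda>t. 1 / complex_of_real t ^ 3)"
  shows "(\<forall>\<nu>\<ge>n+1. set_integrable lborel {real \<nu>..} (\<lambda>t. R (complex_of_real t)))
    \<and> (\<lambda>j. LINT t:{real (n + 1 + j)..}|lborel. R (complex_of_real t)) sums
        ((\<Sum>k=0..n. B k 2) * euler_mascheroni
         + (\<Sum>m=1..n. \<Sum>k=m..n. B k 1 * complex_of_real (ln (real (n + m))))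
         - (\<Sum>k=0..n. B k 2 * harm (n + k)))"
proof -
  note rel = partial_fraction_coeff_relations[OF decay[unfolded R_eq]]
  \<comment> \<open>This one fact serves both conjuncts, integrability and the value of each
    integral; \<open>\<nu> \<ge> n + 1\<close> supplies the positive left endpoint.\<close>
  have int: "has_bochner_integral lborel (\<lambda>t. indicator {real \<nu>..} t *\<^sub>R R (complex_of_real t))
      (\<Sum>k=0..n. B k 2 * of_real (1 / (real \<nu> + real k))
        - B k 1 * of_real (ln (real \<nu> + real k) - ln (real \<nu>)))" if "\<nu> \<ge> n + 1" for \<nu>
    unfolding R_eq using that by (intro has_bochner_integral_partial_fraction_atLeast rel) auto
  have "(LINT t:{real (n + 1 + j)..}|lborel. R (complex_of_real t))
      = (\<Sum>k=0..n. B k 2 * of_real (1 / (real (n + 1 + j) + real k))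
        - B k 1 * of_real (ln (real (n + 1 + j) + real k) - ln (real (n + 1 + j))))" for j
    unfolding set_lebesgue_integral_def
    by (intro has_bochner_integral_integral_eq int) simp
  then show ?thesis
    using partial_fraction_integrals_sums[OF rel(2)] int
    by (simp only: set_integrable_def) (auto simp: has_bochner_integral_iff)
qed

end
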